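(* Let $\mathcal{C}$ be a cartesian closed category which is non-degenerate, i.e. there exist objects $c', c$ of $\mathcal{C}$ and two distinct morphisms $f \neq g : c' \to c$. Then every language of $\lambda$-terms which is syntactically (Hillebrand–Kanellakis) recognizable is $\mathcal{C}$-recognizable: for every simple type $A$ and every $L \subseteq \mathrm{Tm}(A)$ such that there exist a simple type $B$ and a closed term $r \in \mathrm{Tm}(A[B] \to \mathrm{Bool})$ with $L = \{t \in \mathrm{Tm}(A) \mid r\ t[B] =_{\beta\eta} \mathsf{true}\}$, there exist an object $e$ of $\mathcal{C}$ and a subset $F \subseteq \mathcal{C}(1, [\![A]\!]_e)$ such that $L = \{t \in \mathrm{Tm}(A) \mid [\![t]\!]_e \in F\}$.
   Context: Simple types are generated by $A,B ::= o \mid A \to B \mid A \times B \mid 1$; terms are those of the simply typed $\lambda$-calculus with products and unit, with type-annotated abstractions $\lambda(x:A).t$, pairing $\langle t,u\rangle$ and projections $t_i$. $\mathrm{Tm}(A)$ denotes the set of closed terms of type $A$ modulo $\beta\eta$-conversion. CCCs come with specified terminal object, products and exponentials. For a CCC $\mathcal{C}$ and object $c$, $[\![A]\!]_c$ is defined by $[\![o]\!]_c = c$, $[\![A\to B]\!]_c = [\![A]\!]_c \Rightarrow [\![B]\!]_c$, $[\![A\times B]\!]_c = [\![A]\!]_c\times[\![B]\!]_c$, $[\![1]\!]_c = 1$, and $[\![t]\!]_c \in \mathcal{C}(1,[\![A]\!]_c)$ is the standard interpretation of $t\in\mathrm{Tm}(A)$ (equivalently, the unique strict CCC functor from the free CCC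 on one object, whose objects are simple types and whose morphisms $A\to B$ are $\mathrm{Tm}(A\to B)$, sending $o$ to $c$). For simple types $A,B$, $A[B]$ is $A$ with every occurrence of $o$ replaced by $B$, and $t[B]$ is $t$ with every type annotation $A'$ replaced by $A'[B]$; then $t\in\mathrm{Tm}(A)$ implies $t[B]\in\mathrm{Tm}(A[B])$. $\mathrm{Bool} := o\times o \to o$ and $\mathsf{true} := \lambda(x : o\times o).\,x_1$. *)

theory Defs
  imports Main
begin

section \<open>Simply typed terms with products and unit\<close>

datatype ty = Base | Fun ty ty | Prod ty ty | Unit

text \<open>Terms are de Bruijn terms, so syntactic equality is equality up to renaming of bound
  variables. Contexts are lists of types whose head is the type of \<open>Var 0\<close>.\<close>

datatype tm =
    Var nat
  | Lam ty tm
  | App tm tm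
  | MkPair tm tm
  | Fst tm
  | Snd tm
  | Star

inductive typing :: "ty list \<Rightarrow> tm \<Rightarrow> ty \<Rightarrow> bool" where
  ty_Var: "i < length \<Gamma> \<Longrightarrow> typing \<Gamma> (Var i) (\<Gamma> ! i)"
| ty_Lam: "typing (A # \<Gamma>) t B \<Longrightarrow> typing \<Gamma> (Lam A t) (Fun A B)"
| ty_App: "typing \<Gamma> t (Fun A B) \<Longrightarrow> typing \<Gamma> u A \<Longrightarrow> typing \<Gamma> (App t u) B"
| ty_Pair: "typing \<Gamma> t A \<Longrightarrow> typing \<Gamma> u B \<Longrightarrow> typing \<Gamma> (MkPair t u) (Prod A B)"
| ty_Fst: "typing \<Gamma> t (Prod A B) \<Longrightarrow> typing \<Gamma> (Fst t) A"
| ty_Snd: "typing \<Gamma> t (Prod A B) \<Longrightarrow> typing \<Gamma> (Snd t) B"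
| ty_Star: "typing \<Gamma> Star Unit"

primrec lift :: "tm \<Rightarrow> nat \<Rightarrow> tm" where
  "lift (Var i) k = (if i < k then Var i else Var (Suc i))"
| "lift (Lam A t) k = Lam A (lift t (Suc k))"
| "lift (App t u) k = App (lift t k) (lift u k)"
| "lift (MkPair t u) k = MkPair (lift t k) (lift u k)"
| "lift (Fst t) k = Fst (lift t k)"
| "lift (Snd t) k = Snd (lift t k)"
| "lift Star k = Star"

text \<open>\<open>subst t s k\<close> replaces variable \<open>k\<close> by \<open>s\<close> and removes \<open>k\<close> from the context.\<close>

primrec subst :: "tm \<Rightarrow> tm \<Rightarrow> nat \<Rightarrow> tm" where
  "subst (Var i) s k = (if k < i then Var (i - 1) else if i = k then s else Var i)"
| "subst (Lam A t) s k = Lam A (subst t (lift s 0) (Suc k))"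
| "subst (App t u) s k = App (subst t s k) (subst u s k)"
| "subst (MkPair t u) s k = MkPair (subst t s k) (subst u s k)"
| "subst (Fst t) s k = Fst (subst t s k)"
| "subst (Snd t) s k = Snd (subst t s k)"
| "subst Star s k = Star"

inductive beta_eta :: "ty list \<Rightarrow> tm \<Rightarrow> tm \<Rightarrow> ty \<Rightarrow> bool" where
  be_refl: "typing \<Gamma> t A \<Longrightarrow> beta_eta \<Gamma> t t A"
| be_sym: "beta_eta \<Gamma> t u A \<Longrightarrow> beta_eta \<Gamma> u t A"
| be_trans: "beta_eta \<Gamma> t u A \<Longrightarrow> beta_eta \<Gamma> u v A \<Longrightarrow> beta_eta \<Gamma> t v A"
| be_Lam: "beta_eta (A # \<Gamma>) t u B \<Longrightarrow> beta_eta \<Gamma> (Lam A t) (Lam A u) (Fun A B)"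
| be_App: "beta_eta \<Gamma> t t' (Fun A B) \<Longrightarrow> beta_eta \<Gamma> u u' A \<Longrightarrow>
    beta_eta \<Gamma> (App t u) (App t' u') B"
| be_Pair: "beta_eta \<Gamma> t t' A \<Longrightarrow> beta_eta \<Gamma> u u' B \<Longrightarrow>
    beta_eta \<Gamma> (MkPair t u) (MkPair t' u') (Prod A B)"
| be_Fst: "beta_eta \<Gamma> t u (Prod A B) \<Longrightarrow> beta_eta \<Gamma> (Fst t) (Fst u) A"
| be_Snd: "beta_eta \<Gamma> t u (Prod A B) \<Longrightarrow> beta_eta \<Gamma> (Snd t) (Snd u) B"
| beta_Fun: "typing (A # \<Gamma>) t B \<Longrightarrow> typing \<Gamma> u A \<Longrightarrow>
    beta_eta \<Gamma> (App (Lam A t) u) (subst t u 0) B"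
| beta_Fst: "typing \<Gamma> t A \<Longrightarrow> typing \<Gamma> u B \<Longrightarrow> beta_eta \<Gamma> (Fst (MkPair t u)) t A"
| beta_Snd: "typing \<Gamma> t A \<Longrightarrow> typing \<Gamma> u B \<Longrightarrow> beta_eta \<Gamma> (Snd (MkPair t u)) u B"
| eta_Fun: "typing \<Gamma> t (Fun A B) \<Longrightarrow> beta_eta \<Gamma> (Lam A (App (lift t 0) (Var 0))) t (Fun A B)"
| eta_Prod: "typing \<Gamma> t (Prod A B) \<Longrightarrow> beta_eta \<Gamma> (MkPair (Fst t) (Snd t)) t (Prod A B)"
| eta_Unit: "typing \<Gamma> t Unit \<Longrightarrow> beta_eta \<Gamma> t Star Unit"

definition closed_tms :: "ty \<Rightarrow> tm set" where
  "closed_tms A = {t. typing [] t A}"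

definition conv :: "ty \<Rightarrow> (tm \<times> tm) set" where
  "conv A = {(t, u). beta_eta [] t u A}"

definition Tm :: "ty \<Rightarrow> tm set set" where
  "Tm A = closed_tms A // conv A"

primrec ty_inst :: "ty \<Rightarrow> ty \<Rightarrow> ty" where
  "ty_inst Base B = B"
| "ty_inst (Fun A1 A2) B = Fun (ty_inst A1 B) (ty_inst A2 B)"
| "ty_inst (Prod A1 A2) B = Prod (ty_inst A1 B) (ty_inst A2 B)"
| "ty_inst Unit B = Unit"

primrec tm_inst :: "tm \<Rightarrow> ty \<Rightarrow> tm" where
  "tm_inst (Var i) B = Var i"
| "tm_inst (Lam A t) B = Lam (ty_inst A B) (tm_inst t B)"
| "tm_inst (App t u) B = App (tm_inst t B) (tm_inst u B)"
| "tm_inst (MkPair t u) B = MkPair (tm_inst t B) (tm_inst u B)"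
| "tm_inst (Fst t) B = Fst (tm_inst t B)"
| "tm_inst (Snd t) B = Snd (tm_inst t B)"
| "tm_inst Star B = Star"

definition Bool :: ty where
  "Bool = Fun (Prod Base Base) Base"

definition true_tm :: tm where
  "true_tm = Lam (Prod Base Base) (Fst (Var 0))"

text \<open>The operations \<open>r, t \<mapsto> r t\<close> and \<open>t \<mapsto> t[B]\<close> on conversion classes; the type argument
  \<open>A\<close> is the type of the resulting class.\<close>

definition Tm_app :: "ty \<Rightarrow> tm set \<Rightarrow> tm set \<Rightarrow> tm set" where
  "Tm_app A R T = (\<Union>r\<in>R. \<Union>t\<in>T. conv A `` {App r t})"

definition Tm_inst :: "ty \<Rightarrow> tm set \<Rightarrow> ty \<Rightarrow> tm set" where
  "Tm_inst A T B = (\<Union>t\<in>T. conv A `` {tm_inst t B})"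

definition true_class :: "tm set" where
  "true_class = conv Bool `` {true_tm}"


section \<open>Cartesian closed categories with specified structure\<close>

record ('o, 'm) category =
  Obj :: "'o set"
  Arr :: "'m set"
  Dom :: "'m \<Rightarrow> 'o"
  Cod :: "'m \<Rightarrow> 'o"
  Ide :: "'o \<Rightarrow> 'm"
  Comp :: "'m \<Rightarrow> 'm \<Rightarrow> 'm" (infixr "\<cdot>\<index>" 70)

definition hom :: "('o, 'm, 'z) category_scheme \<Rightarrow> 'o \<Rightarrow> 'o \<Rightarrow> 'm set" where
  "hom C a b = {f \<in> Arr C. Dom C f = a \<and> Cod C f = b}"

locale category =
  fixes C :: "('o, 'm, 'z) category_scheme" (structure)
  assumes Dom_Obj: "f \<in> Arr C \<Longrightarrow> Dom C f \<in> Obj C"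
    and Cod_Obj: "f \<in> Arr C \<Longrightarrow> Cod C f \<in> Obj C"
    and Ide_hom: "a \<in> Obj C \<Longrightarrow> Ide C a \<in> hom C a a"
    and Comp_hom: "f \<in> hom C a b \<Longrightarrow> g \<in> hom C b c \<Longrightarrow> g \<cdot> f \<in> hom C a c"
    and Comp_Ide: "f \<in> hom C a b \<Longrightarrow> f \<cdot> Ide C a = f"
    and Ide_Comp: "f \<in> hom C a b \<Longrightarrow> Ide C b \<cdot> f = f"
    and Comp_assoc: "f \<in> hom C a b \<Longrightarrow> g \<in> hom C b c \<Longrightarrow> h \<in> hom C c d \<Longrightarrow>
      (h \<cdot> g) \<cdot> f = h \<cdot> (g \<cdot> f)"

record ('o, 'm) ccc = "('o, 'm) category" +
  One :: 'o
  Times :: "'o \<Rightarrow> 'o \<Rightarrow> 'o"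
  Pr1 :: "'o \<Rightarrow> 'o \<Rightarrow> 'm"
  Pr2 :: "'o \<Rightarrow> 'o \<Rightarrow> 'm"
  Exp :: "'o \<Rightarrow> 'o \<Rightarrow> 'o"
  Eval :: "'o \<Rightarrow> 'o \<Rightarrow> 'm"

definition bang :: "('o, 'm, 'z) ccc_scheme \<Rightarrow> 'o \<Rightarrow> 'm" where
  "bang C a = (THE h. h \<in> hom C a (One C))"

definition tuple :: "('o, 'm, 'z) ccc_scheme \<Rightarrow> 'm \<Rightarrow> 'm \<Rightarrow> 'm" where
  "tuple C f g = (THE h. h \<in> hom C (Dom C f) (Times C (Cod C f) (Cod C g)) \<and>
     Pr1 C (Cod C f) (Cod C g) \<cdot>\<^bsub>C\<^esub> h = f \<and> Pr2 C (Cod C f) (Cod C g) \<cdot>\<^bsub>C\<^esub> h = g)"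

text \<open>\<open>Exp C b c\<close> is the exponential \<open>b \<Rightarrow> c\<close> and \<open>Eval C b c : (b \<Rightarrow> c) \<times> b \<rightarrow> c\<close>.
  \<open>ccc_uncurry C a b c\<close> and \<open>ccc_curry C a b\<close> are the two directions of the correspondence between
  arrows \<open>a \<rightarrow> (b \<Rightarrow> c)\<close> and arrows \<open>a \<times> b \<rightarrow> c\<close>.\<close>

definition ccc_uncurry :: "('o, 'm, 'z) ccc_scheme \<Rightarrow> 'o \<Rightarrow> 'o \<Rightarrow> 'o \<Rightarrow> 'm \<Rightarrow> 'm" where
  "ccc_uncurry C a b c h = Eval C b c \<cdot>\<^bsub>C\<^esub> tuple C (h \<cdot>\<^bsub>C\<^esub> Pr1 C a b) (Pr2 C a b)"

definition ccc_curry :: "('o, 'm, 'z) ccc_scheme \<Rightarrow> 'o \<Rightarrow> 'o \<Rightarrow> 'm \<Rightarrow> 'm" where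
  "ccc_curry C a b f = (THE h. h \<in> hom C a (Exp C b (Cod C f)) \<and> ccc_uncurry C a b (Cod C f) h = f)"

locale cartesian_closed_category = category C
  for C :: "('o, 'm, 'z) ccc_scheme" (structure) +
  assumes One_Obj: "One C \<in> Obj C"
    and One_universal: "a \<in> Obj C \<Longrightarrow> \<exists>!h. h \<in> hom C a (One C)"
    and Times_Obj: "a \<in> Obj C \<Longrightarrow> b \<in> Obj C \<Longrightarrow> Times C a b \<in> Obj C"
    and Pr1_hom: "a \<in> Obj C \<Longrightarrow> b \<in> Obj C \<Longrightarrow> Pr1 C a b \<in> hom C (Times C a b) a"
    and Pr2_hom: "a \<in> Obj C \<Longrightarrow> b \<in> Obj C \<Longrightarrow> Pr2 C a b \<in> hom C (Times C a b) b"
    and Times_universal: "f \<in> hom C x a \<Longrightarrow> g \<in> hom C x b \<Longrightarrow>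
      \<exists>!h. h \<in> hom C x (Times C a b) \<and> Pr1 C a b \<cdot> h = f \<and> Pr2 C a b \<cdot> h = g"
    and Exp_Obj: "b \<in> Obj C \<Longrightarrow> c \<in> Obj C \<Longrightarrow> Exp C b c \<in> Obj C"
    and Eval_hom: "b \<in> Obj C \<Longrightarrow> c \<in> Obj C \<Longrightarrow> Eval C b c \<in> hom C (Times C (Exp C b c) b) c"
    and Exp_universal: "a \<in> Obj C \<Longrightarrow> b \<in> Obj C \<Longrightarrow> f \<in> hom C (Times C a b) c \<Longrightarrow>
      \<exists>!h. h \<in> hom C a (Exp C b c) \<and> ccc_uncurry C a b c h = f"

definition nondegenerate :: "('o, 'm, 'z) category_scheme \<Rightarrow> bool" where
  "nondegenerate C \<longleftrightarrow>
     (\<exists>c' \<in> Obj C. \<exists>c \<in> Obj C. \<exists>f \<in> hom C c' c. \<exists>g \<in> hom C c' c. f \<noteq> g)"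


section \<open>Interpretation of terms\<close>

primrec ty_sem :: "('o, 'm, 'z) ccc_scheme \<Rightarrow> 'o \<Rightarrow> ty \<Rightarrow> 'o" where
  "ty_sem C c Base = c"
| "ty_sem C c (Fun A B) = Exp C (ty_sem C c A) (ty_sem C c B)"
| "ty_sem C c (Prod A B) = Times C (ty_sem C c A) (ty_sem C c B)"
| "ty_sem C c Unit = One C"

primrec ctx_sem :: "('o, 'm, 'z) ccc_scheme \<Rightarrow> 'o \<Rightarrow> ty list \<Rightarrow> 'o" where
  "ctx_sem C c [] = One C"
| "ctx_sem C c (A # \<Gamma>) = Times C (ctx_sem C c \<Gamma>) (ty_sem C c A)"

text \<open>The unique type of a typable term, see \<open>ty_of_eq\<close> below; junk on other terms.\<close>

primrec ty_of :: "tm \<Rightarrow> ty list \<Rightarrow> ty" where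
  "ty_of (Var i) \<Gamma> = \<Gamma> ! i"
| "ty_of (Lam A t) \<Gamma> = Fun A (ty_of t (A # \<Gamma>))"
| "ty_of (App t u) \<Gamma> = (case ty_of t \<Gamma> of Fun A B \<Rightarrow> B | _ \<Rightarrow> undefined)"
| "ty_of (MkPair t u) \<Gamma> = Prod (ty_of t \<Gamma>) (ty_of u \<Gamma>)"
| "ty_of (Fst t) \<Gamma> = (case ty_of t \<Gamma> of Prod A B \<Rightarrow> A | _ \<Rightarrow> undefined)"
| "ty_of (Snd t) \<Gamma> = (case ty_of t \<Gamma> of Prod A B \<Rightarrow> B | _ \<Rightarrow> undefined)"
| "ty_of Star \<Gamma> = Unit"

primrec var_sem :: "('o, 'm, 'z) ccc_scheme \<Rightarrow> 'o \<Rightarrow> ty list \<Rightarrow> nat \<Rightarrow> 'm" where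
  "var_sem C c [] i = undefined"
| "var_sem C c (A # \<Gamma>) i =
    (case i of
       0 \<Rightarrow> Pr2 C (ctx_sem C c \<Gamma>) (ty_sem C c A)
     | Suc j \<Rightarrow> var_sem C c \<Gamma> j \<cdot>\<^bsub>C\<^esub> Pr1 C (ctx_sem C c \<Gamma>) (ty_sem C c A))"

text \<open>For \<open>typing \<Gamma> t A\<close>, \<open>tm_sem C c t \<Gamma>\<close> is an arrow \<open>ctx_sem C c \<Gamma> \<rightarrow> ty_sem C c A\<close>.\<close>

primrec tm_sem :: "('o, 'm, 'z) ccc_scheme \<Rightarrow> 'o \<Rightarrow> tm \<Rightarrow> ty list \<Rightarrow> 'm" where
  "tm_sem C c (Var i) \<Gamma> = var_sem C c \<Gamma> i"
| "tm_sem C c (Lam A t) \<Gamma> = ccc_curry C (ctx_sem C c \<Gamma>) (ty_sem C c A) (tm_sem C c t (A # \<Gamma>))"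
| "tm_sem C c (App t u) \<Gamma> =
    (case ty_of t \<Gamma> of
       Fun A B \<Rightarrow> Eval C (ty_sem C c A) (ty_sem C c B) \<cdot>\<^bsub>C\<^esub> tuple C (tm_sem C c t \<Gamma>) (tm_sem C c u \<Gamma>)
     | _ \<Rightarrow> undefined)"
| "tm_sem C c (MkPair t u) \<Gamma> = tuple C (tm_sem C c t \<Gamma>) (tm_sem C c u \<Gamma>)"
| "tm_sem C c (Fst t) \<Gamma> =
    (case ty_of t \<Gamma> of
       Prod A B \<Rightarrow> Pr1 C (ty_sem C c A) (ty_sem C c B) \<cdot>\<^bsub>C\<^esub> tm_sem C c t \<Gamma>
     | _ \<Rightarrow> undefined)"
| "tm_sem C c (Snd t) \<Gamma> =
    (case ty_of t \<Gamma> of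
       Prod A B \<Rightarrow> Pr2 C (ty_sem C c A) (ty_sem C c B) \<cdot>\<^bsub>C\<^esub> tm_sem C c t \<Gamma>
     | _ \<Rightarrow> undefined)"
| "tm_sem C c Star \<Gamma> = bang C (ctx_sem C c \<Gamma>)"

text \<open>The common interpretation of the members of a conversion class.\<close>

definition Tm_sem :: "('o, 'm, 'z) ccc_scheme \<Rightarrow> 'o \<Rightarrow> tm set \<Rightarrow> 'm" where
  "Tm_sem C c T = the_elem ((\<lambda>t. tm_sem C c t []) ` T)"


section \<open>Recognizable languages\<close>

definition syntactically_recognizable :: "ty \<Rightarrow> tm set set \<Rightarrow> bool" where
  "syntactically_recognizable A L \<longleftrightarrow>
     (\<exists>B. \<exists>r \<in> Tm (Fun (ty_inst A B) Bool).
        L = {t \<in> Tm A. Tm_app Bool r (Tm_inst (ty_inst A B) t B) = true_class})"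

definition recognizable :: "('o, 'm, 'z) ccc_scheme \<Rightarrow> ty \<Rightarrow> tm set set \<Rightarrow> bool" where
  "recognizable C A L \<longleftrightarrow>
     (\<exists>e \<in> Obj C. \<exists>F \<subseteq> hom C (One C) (ty_sem C e A). L = {t \<in> Tm A. Tm_sem C e t \<in> F})"


section \<open>Well-definedness of the operations on conversion classes\<close>

lemma ty_of_eq: "typing \<Gamma> t A \<Longrightarrow> ty_of t \<Gamma> = A"
  by (induction rule: typing.induct) auto

lemma typing_lift_gen:
  assumes "typing \<Gamma> t A"
    and "\<And>i. i < length \<Gamma> \<Longrightarrow> typing \<Gamma>' (lift (Var i) k) (\<Gamma> ! i)"
  shows "typing \<Gamma>' (lift t k) A"
  using assms
proof (induction arbitrary: \<Gamma>' k rule: typing.induct)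
  case (ty_Lam A \<Gamma> t B)
  have "typing (A # \<Gamma>') (lift (Var i) (Suc k)) ((A # \<Gamma>) ! i)" if i: "i < length (A # \<Gamma>)" for i
  proof (cases i)
    case 0
    then show ?thesis using typing.ty_Var[of 0 "A # \<Gamma>'"] by simp
  next
    case (Suc j)
    then have "typing \<Gamma>' (lift (Var j) k) (\<Gamma> ! j)" using i ty_Lam.prems by simp
    then show ?thesis using Suc
      by (auto split: if_splits elim!: typing.cases[of \<Gamma>' "Var _"])
         (metis typing.ty_Var length_Cons Suc_less_eq nth_Cons_Suc)+
  qed
  then show ?case using ty_Lam.IH by (auto intro: typing.ty_Lam)
next
  case (ty_App \<Gamma> t A B u)
  then show ?case by (metis lift.simps(3) typing.ty_App)
qed (auto intro: typing.intros simp del: lift.simps(1))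

lemma typing_lift: "typing \<Gamma> t A \<Longrightarrow> typing (B # \<Gamma>) (lift t 0) A"
  by (erule typing_lift_gen) (use typing.ty_Var[of "Suc _" "B # \<Gamma>"] in auto)

lemma subst_Var_Suc: "subst (Var (Suc j)) (lift s 0) (Suc k) = lift (subst (Var j) s k) 0"
  by (cases j) auto

lemma typing_subst_gen:
  assumes "typing \<Gamma> t A"
    and "\<And>i. i < length \<Gamma> \<Longrightarrow> typing \<Gamma>' (subst (Var i) s k) (\<Gamma> ! i)"
  shows "typing \<Gamma>' (subst t s k) A"
  using assms
proof (induction arbitrary: \<Gamma>' s k rule: typing.induct)
  case (ty_Lam A \<Gamma> t B)
  have "typing (A # \<Gamma>') (subst (Var i) (lift s 0) (Suc k)) ((A # \<Gamma>) ! i)"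
    if i: "i < length (A # \<Gamma>)" for i
  proof (cases i)
    case 0
    then show ?thesis using typing.ty_Var[of 0 "A # \<Gamma>'"] by simp
  next
    case (Suc j)
    then have "typing \<Gamma>' (subst (Var j) s k) (\<Gamma> ! j)" using i ty_Lam.prems by simp
    then show ?thesis unfolding Suc subst_Var_Suc by (simp add: typing_lift)
  qed
  then show ?case using ty_Lam.IH by (auto intro: typing.ty_Lam)
next
  case (ty_App \<Gamma> t A B u)
  then show ?case by (metis subst.simps(3) typing.ty_App)
qed (auto intro: typing.intros simp del: subst.simps(1))

lemma typing_subst_Var:
  assumes "typing \<Gamma> u A" "i < length (A # \<Gamma>)"
  shows "typing \<Gamma> (subst (Var i) u 0) ((A # \<Gamma>) ! i)"
  using assms by (cases i) (auto intro: typing.ty_Var)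

lemma typing_subst: "typing (A # \<Gamma>) t B \<Longrightarrow> typing \<Gamma> u A \<Longrightarrow> typing \<Gamma> (subst t u 0) B"
  by (erule typing_subst_gen) (rule typing_subst_Var)

lemma beta_eta_typing: "beta_eta \<Gamma> t u A \<Longrightarrow> typing \<Gamma> t A \<and> typing \<Gamma> u A"
proof (induction rule: beta_eta.induct)
  case (eta_Fun \<Gamma> t A B)
  then show ?case using typing.ty_Var[of 0 "A # \<Gamma>"] by (auto intro!: typing.intros typing_lift)
qed (auto intro: typing.intros typing_subst)

lemma equiv_conv: "equiv (closed_tms A) (conv A)"
  unfolding closed_tms_def conv_def
  by (rule equivI)
     (auto simp: refl_on_def sym_def trans_def dest: beta_eta_typing intro: beta_eta.intros)

lemma TmE:
  assumes "T \<in> Tm A"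
  obtains t where "typing [] t A" "T = conv A `` {t}"
  using assms unfolding Tm_def quotient_def closed_tms_def by auto

lemma tm_inst_lift: "tm_inst (lift t k) B = lift (tm_inst t B) k"
  by (induction t arbitrary: k) auto

lemma tm_inst_subst: "tm_inst (subst t s k) B = subst (tm_inst t B) (tm_inst s B) k"
  by (induction t arbitrary: s k) (auto simp: tm_inst_lift)

lemma typing_inst:
  "typing \<Gamma> t A \<Longrightarrow> typing (map (\<lambda>A. ty_inst A B) \<Gamma>) (tm_inst t B) (ty_inst A B)"
proof (induction rule: typing.induct)
  case (ty_Var i \<Gamma>)
  then show ?case using typing.ty_Var[of i "map (\<lambda>A. ty_inst A B) \<Gamma>"] by simp
qed (auto intro: typing.intros)

lemma beta_eta_inst:
  "beta_eta \<Gamma> t u A \<Longrightarrow>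
   beta_eta (map (\<lambda>A. ty_inst A B) \<Gamma>) (tm_inst t B) (tm_inst u B) (ty_inst A B)"
proof (induction rule: beta_eta.induct)
  case (be_sym \<Gamma> t u A)
  then show ?case by (blast intro: beta_eta.be_sym)
next
  case (be_trans \<Gamma> t u A v)
  then show ?case by (blast intro: beta_eta.be_trans)
next
  case (beta_Fun A \<Gamma> t C u)
  then show ?case
    using beta_eta.beta_Fun typing_inst[of "A # \<Gamma>" t C B] typing_inst[of \<Gamma> u A B]
    by (simp add: tm_inst_subst)
next
  case (eta_Fun \<Gamma> t A C)
  then show ?case using beta_eta.eta_Fun typing_inst[of \<Gamma> t "Fun A C" B]
    by (simp add: tm_inst_lift)
next
  case (eta_Prod \<Gamma> t A C)
  then show ?case using beta_eta.eta_Prod typing_inst[of \<Gamma> t "Prod A C" B] by simp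
next
  case (eta_Unit \<Gamma> t)
  then show ?case using beta_eta.eta_Unit typing_inst[of \<Gamma> t "Unit" B] by simp
qed (auto intro: beta_eta.intros dest: typing_inst)

lemma conv_Union_eq:
  assumes "\<And>x. x \<in> X \<Longrightarrow> beta_eta [] u (f x) A" "X \<noteq> {}"
  shows "(\<Union>x\<in>X. conv A `` {f x}) = conv A `` {u}"
proof -
  have "conv A `` {f x} = conv A `` {u}" if "x \<in> X" for x
    using assms(1)[OF that] unfolding conv_def by (blast intro: beta_eta.be_trans beta_eta.be_sym)
  then show ?thesis using assms(2) by blast
qed

lemma Tm_app_eq:
  assumes "typing [] r (Fun A B)" "typing [] t A"
  shows "Tm_app B (conv (Fun A B) `` {r}) (conv A `` {t}) = conv B `` {App r t}"
proof -
  have "(\<Union>p \<in> (conv (Fun A B) `` {r}) \<times> (conv A `` {t}). conv B `` {App (fst p) (snd p)})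
      = conv B `` {App r t}"
    by (rule conv_Union_eq)
       (use assms in \<open>auto simp: conv_def intro: beta_eta.be_App beta_eta.be_refl\<close>)
  moreover have "Tm_app B R T = (\<Union>p \<in> R \<times> T. conv B `` {App (fst p) (snd p)})" for R T
    unfolding Tm_app_def by force
  ultimately show ?thesis by simp
qed

lemma Tm_inst_eq:
  assumes "typing [] t A"
  shows "Tm_inst (ty_inst A B) (conv A `` {t}) B = conv (ty_inst A B) `` {tm_inst t B}"
  unfolding Tm_inst_def
  by (rule conv_Union_eq)
     (use assms beta_eta_inst[of "[]"] in \<open>auto simp: conv_def intro: beta_eta.be_refl\<close>)

lemma true_class_Tm: "true_class \<in> Tm Bool"
proof -
  have "typing [] true_tm Bool"
    unfolding true_tm_def Bool_def
    using typing.ty_Var[of 0 "[Prod Base Base]"] by (auto intro!: typing.intros)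
  then show ?thesis
    unfolding true_class_def Tm_def closed_tms_def by (auto intro: quotientI)
qed

context cartesian_closed_category
begin

lemma hom_ObjD: "f \<in> hom C a b \<Longrightarrow> a \<in> Obj C \<and> b \<in> Obj C"
  using Dom_Obj Cod_Obj by (auto simp: hom_def)

lemma tuple_props:
  assumes f: "f \<in> hom C x a" and g: "g \<in> hom C x b"
  shows tuple_hom: "tuple C f g \<in> hom C x (Times C a b)"
    and Pr1_tuple: "Pr1 C a b \<cdot> tuple C f g = f"
    and Pr2_tuple: "Pr2 C a b \<cdot> tuple C f g = g"
proof -
  have eq: "Dom C f = x" "Cod C f = a" "Cod C g = b" using f g by (auto simp: hom_def)
  show "tuple C f g \<in> hom C x (Times C a b)" "Pr1 C a b \<cdot> tuple C f g = f"
    "Pr2 C a b \<cdot> tuple C f g = g"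
    using theI'[OF Times_universal[OF f g]] unfolding tuple_def eq by blast+
qed

lemma tuple_unique:
  assumes "h \<in> hom C x (Times C a b)" "a \<in> Obj C" "b \<in> Obj C"
    and "Pr1 C a b \<cdot> h = f" "Pr2 C a b \<cdot> h = g"
  shows "h = tuple C f g"
proof -
  have f: "f \<in> hom C x a" "g \<in> hom C x b"
    using assms Comp_hom Pr1_hom Pr2_hom by metis+
  show ?thesis using Times_universal[OF f] tuple_props[OF f] assms by blast
qed

lemma tuple_comp:
  assumes "f \<in> hom C x a" "g \<in> hom C x b" "m \<in> hom C y x"
  shows "tuple C f g \<cdot> m = tuple C (f \<cdot> m) (g \<cdot> m)"
proof (rule tuple_unique)
  have o: "a \<in> Obj C" "b \<in> Obj C" using assms hom_ObjD by blast+
  then show "a \<in> Obj C" "b \<in> Obj C" .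
  show "tuple C f g \<cdot> m \<in> hom C y (Times C a b)"
    using assms Comp_hom tuple_hom by blast
  show "Pr1 C a b \<cdot> tuple C f g \<cdot> m = f \<cdot> m" "Pr2 C a b \<cdot> tuple C f g \<cdot> m = g \<cdot> m"
    using Comp_assoc[OF assms(3) tuple_hom[OF assms(1,2)] Pr1_hom[OF o]]
      Comp_assoc[OF assms(3) tuple_hom[OF assms(1,2)] Pr2_hom[OF o]]
      Pr1_tuple[OF assms(1,2)] Pr2_tuple[OF assms(1,2)] by simp_all
qed

lemma bang_hom: "a \<in> Obj C \<Longrightarrow> bang C a \<in> hom C a (One C)"
  unfolding bang_def by (rule theI') (rule One_universal)

lemma bang_unique: "h \<in> hom C a (One C) \<Longrightarrow> h = bang C a"
  using bang_hom One_universal hom_ObjD by blast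

lemma curry_props:
  assumes "a \<in> Obj C" "b \<in> Obj C" and f: "f \<in> hom C (Times C a b) c"
  shows curry_hom: "ccc_curry C a b f \<in> hom C a (Exp C b c)"
    and uncurry_curry: "ccc_uncurry C a b c (ccc_curry C a b f) = f"
proof -
  have eq: "Cod C f = c" using f by (auto simp: hom_def)
  show "ccc_curry C a b f \<in> hom C a (Exp C b c)"
    "ccc_uncurry C a b c (ccc_curry C a b f) = f"
    using theI'[OF Exp_universal[OF assms]] unfolding ccc_curry_def eq by blast+
qed

lemma uncurry_hom:
  assumes "a \<in> Obj C" "b \<in> Obj C" "c \<in> Obj C" "h \<in> hom C a (Exp C b c)"
  shows "ccc_uncurry C a b c h \<in> hom C (Times C a b) c"
  unfolding ccc_uncurry_def using assms
  by (meson Comp_hom Eval_hom Pr1_hom Pr2_hom tuple_hom)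

lemma curry_unique:
  assumes "a \<in> Obj C" "b \<in> Obj C" "c \<in> Obj C" "h \<in> hom C a (Exp C b c)"
    and "ccc_uncurry C a b c h = f"
  shows "h = ccc_curry C a b f"
proof -
  have f: "f \<in> hom C (Times C a b) c" using assms uncurry_hom by blast
  show ?thesis using Exp_universal[OF assms(1,2) f] curry_props[OF assms(1,2) f] assms by blast
qed

lemma uncurry_comp_tuple:
  assumes o: "a \<in> Obj C" "b \<in> Obj C" "c \<in> Obj C" and h: "h \<in> hom C a (Exp C b c)"
    and m: "m \<in> hom C x a" and n: "n \<in> hom C x b"
  shows "ccc_uncurry C a b c h \<cdot> tuple C m n = Eval C b c \<cdot> tuple C (h \<cdot> m) n"
proof -
  note p = Pr1_hom[OF o(1,2)] Pr2_hom[OF o(1,2)]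
  note hp = Comp_hom[OF p(1) h]
  note t = tuple_hom[OF m n]
  have "ccc_uncurry C a b c h \<cdot> tuple C m n
      = Eval C b c \<cdot> tuple C (h \<cdot> Pr1 C a b) (Pr2 C a b) \<cdot> tuple C m n"
    unfolding ccc_uncurry_def
    by (rule Comp_assoc[OF t tuple_hom[OF hp p(2)] Eval_hom[OF o(2,3)]])
  also have "tuple C (h \<cdot> Pr1 C a b) (Pr2 C a b) \<cdot> tuple C m n = tuple C (h \<cdot> m) n"
    using tuple_comp[OF hp p(2) t] Comp_assoc[OF t p(1) h] Pr1_tuple[OF m n] Pr2_tuple[OF m n]
    by simp
  finally show ?thesis .
qed

lemma curry_comp:
  assumes o: "a \<in> Obj C" "b \<in> Obj C" and f: "f \<in> hom C (Times C a b) c" and m: "m \<in> hom C x a"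
  shows "ccc_curry C a b f \<cdot> m
       = ccc_curry C x b (f \<cdot> tuple C (m \<cdot> Pr1 C x b) (Pr2 C x b))"
proof (rule curry_unique)
  have x: "x \<in> Obj C" and c: "c \<in> Obj C" using m f hom_ObjD by blast+
  then show "x \<in> Obj C" "c \<in> Obj C" "b \<in> Obj C" using o by auto
  note h = curry_hom[OF o f]
  show "ccc_curry C a b f \<cdot> m \<in> hom C x (Exp C b c)" using Comp_hom[OF m h] .
  note p = Pr1_hom[OF x o(2)] Pr2_hom[OF x o(2)]
  show "ccc_uncurry C x b c (ccc_curry C a b f \<cdot> m) = f \<cdot> tuple C (m \<cdot> Pr1 C x b) (Pr2 C x b)"
    using uncurry_comp_tuple[OF o c h Comp_hom[OF p(1) m] p(2)] uncurry_curry[OF o f]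
      Comp_assoc[OF p(1) m h]
    unfolding ccc_uncurry_def by simp
qed

context
  fixes c assumes c: "c \<in> Obj C"
begin

lemma ty_sem_Obj [simp]: "ty_sem C c A \<in> Obj C"
  by (induction A) (auto simp: c Exp_Obj Times_Obj One_Obj)

lemma ctx_sem_Obj [simp]: "ctx_sem C c \<Gamma> \<in> Obj C"
  by (induction \<Gamma>) (auto simp: Times_Obj One_Obj)

lemma var_sem_hom: "i < length \<Gamma> \<Longrightarrow> var_sem C c \<Gamma> i \<in> hom C (ctx_sem C c \<Gamma>) (ty_sem C c (\<Gamma> ! i))"
  by (induction \<Gamma> arbitrary: i)
     (auto simp: Pr2_hom split: nat.split intro!: Comp_hom Pr1_hom)

lemma tm_sem_hom: "typing \<Gamma> t A \<Longrightarrow> tm_sem C c t \<Gamma> \<in> hom C (ctx_sem C c \<Gamma>) (ty_sem C c A)"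
proof (induction rule: typing.induct)
  case (ty_App \<Gamma> t A B u)
  then show ?case
    by (auto simp: ty_of_eq intro!: Comp_hom[OF tuple_hom Eval_hom])
next
  case (ty_Lam A \<Gamma> t B)
  then show ?case by (auto intro!: curry_hom)
next
  case (ty_Fst \<Gamma> t A B)
  then show ?case by (auto simp: ty_of_eq intro!: Comp_hom[OF _ Pr1_hom])
next
  case (ty_Snd \<Gamma> t A B)
  then show ?case by (auto simp: ty_of_eq intro!: Comp_hom[OF _ Pr2_hom])
qed (auto simp: var_sem_hom tuple_hom bang_hom)

lemma tm_sem_transport:
  assumes "typing \<Gamma> t A"
    and "m \<in> hom C (ctx_sem C c \<Gamma>') (ctx_sem C c \<Gamma>)"
    and "P \<Gamma>' \<Gamma> m \<theta>"
    and P_Var: "\<And>\<Gamma>' \<Gamma> m \<theta> i. P \<Gamma>' \<Gamma> m \<theta> \<Longrightarrow> i < length \<Gamma> \<Longrightarrow>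
      typing \<Gamma>' (act (Var i) \<theta>) (\<Gamma> ! i) \<and>
      tm_sem C c (act (Var i) \<theta>) \<Gamma>' = var_sem C c \<Gamma> i \<cdot> m"
    and P_up: "\<And>\<Gamma>' \<Gamma> m \<theta> A. P \<Gamma>' \<Gamma> m \<theta> \<Longrightarrow> m \<in> hom C (ctx_sem C c \<Gamma>') (ctx_sem C c \<Gamma>) \<Longrightarrow>
      P (A # \<Gamma>') (A # \<Gamma>)
        (tuple C (m \<cdot> Pr1 C (ctx_sem C c \<Gamma>') (ty_sem C c A)) (Pr2 C (ctx_sem C c \<Gamma>') (ty_sem C c A)))
        (up \<theta>)"
    and act: "\<And>A t \<theta>. act (Lam A t) \<theta> = Lam A (act t (up \<theta>))"
      "\<And>t u \<theta>. act (App t u) \<theta> = App (act t \<theta>) (act u \<theta>)"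
      "\<And>t u \<theta>. act (MkPair t u) \<theta> = MkPair (act t \<theta>) (act u \<theta>)"
      "\<And>t \<theta>. act (Fst t) \<theta> = Fst (act t \<theta>)"
      "\<And>t \<theta>. act (Snd t) \<theta> = Snd (act t \<theta>)"
      "\<And>\<theta>. act Star \<theta> = Star"
  shows "typing \<Gamma>' (act t \<theta>) A \<and> tm_sem C c (act t \<theta>) \<Gamma>' = tm_sem C c t \<Gamma> \<cdot> m"
  using assms(1-3)
proof (induction arbitrary: \<Gamma>' m \<theta> rule: typing.induct)
  case (ty_Var i \<Gamma>)
  then show ?case using P_Var by simp
next
  case (ty_Lam A \<Gamma> t B)
  let ?p = "Pr1 C (ctx_sem C c \<Gamma>') (ty_sem C c A)" and ?q = "Pr2 C (ctx_sem C c \<Gamma>') (ty_sem C c A)"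
  have m': "tuple C (m \<cdot> ?p) ?q \<in> hom C (ctx_sem C c (A # \<Gamma>')) (ctx_sem C c (A # \<Gamma>))"
    using ty_Lam.prems(1) by (auto intro!: tuple_hom Comp_hom[OF Pr1_hom] Pr2_hom)
  have IH: "typing (A # \<Gamma>') (act t (up \<theta>)) B \<and>
      tm_sem C c (act t (up \<theta>)) (A # \<Gamma>') = tm_sem C c t (A # \<Gamma>) \<cdot> tuple C (m \<cdot> ?p) ?q"
    using ty_Lam.IH[OF m' P_up[OF ty_Lam.prems(2,1)]] .
  then show ?case
    using curry_comp[OF _ _ tm_sem_hom[OF ty_Lam.hyps, unfolded ctx_sem.simps] ty_Lam.prems(1)]
    by (simp add: act typing.ty_Lam)
next
  case (ty_App \<Gamma> t A B u)
  have IH: "typing \<Gamma>' (act t \<theta>) (Fun A B)" "tm_sem C c (act t \<theta>) \<Gamma>' = tm_sem C c t \<Gamma> \<cdot> m"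
    "typing \<Gamma>' (act u \<theta>) A" "tm_sem C c (act u \<theta>) \<Gamma>' = tm_sem C c u \<Gamma> \<cdot> m"
    using ty_App.IH ty_App.prems by blast+
  note h = tm_sem_hom[OF ty_App.hyps(1), unfolded ty_sem.simps] tm_sem_hom[OF ty_App.hyps(2)]
  show ?case
    using IH ty_App.hyps tuple_comp[OF h ty_App.prems(1)]
      Comp_assoc[OF ty_App.prems(1) tuple_hom[OF h] Eval_hom]
    by (auto simp: act ty_of_eq intro: typing.ty_App)
next
  case (ty_Pair \<Gamma> t A u B)
  have IH: "typing \<Gamma>' (act t \<theta>) A" "tm_sem C c (act t \<theta>) \<Gamma>' = tm_sem C c t \<Gamma> \<cdot> m"
    "typing \<Gamma>' (act u \<theta>) B" "tm_sem C c (act u \<theta>) \<Gamma>' = tm_sem C c u \<Gamma> \<cdot> m"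
    using ty_Pair.IH ty_Pair.prems by blast+
  note h = tm_sem_hom[OF ty_Pair.hyps(1)] tm_sem_hom[OF ty_Pair.hyps(2)]
  show ?case using IH tuple_comp[OF h ty_Pair.prems(1)]
    by (auto simp: act intro: typing.ty_Pair)
next
  case (ty_Fst \<Gamma> t A B)
  then have "typing \<Gamma>' (act t \<theta>) (Prod A B)" "tm_sem C c (act t \<theta>) \<Gamma>' = tm_sem C c t \<Gamma> \<cdot> m"
    by blast+
  then show ?case
    using ty_Fst.hyps
      Comp_assoc[OF ty_Fst.prems(1) tm_sem_hom[OF ty_Fst.hyps, unfolded ty_sem.simps] Pr1_hom]
    by (auto simp: act ty_of_eq intro: typing.ty_Fst)
next
  case (ty_Snd \<Gamma> t A B)
  then have "typing \<Gamma>' (act t \<theta>) (Prod A B)" "tm_sem C c (act t \<theta>) \<Gamma>' = tm_sem C c t \<Gamma> \<cdot> m"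
    by blast+
  then show ?case
    using ty_Snd.hyps
      Comp_assoc[OF ty_Snd.prems(1) tm_sem_hom[OF ty_Snd.hyps, unfolded ty_sem.simps] Pr2_hom]
    by (auto simp: act ty_of_eq intro: typing.ty_Snd)
next
  case (ty_Star \<Gamma>)
  then show ?case using bang_unique[OF Comp_hom[OF ty_Star.prems(1) bang_hom]]
    by (auto simp: act intro: typing.ty_Star)
qed

lemma tm_sem_lift:
  assumes t: "typing \<Gamma> t A"
  shows "tm_sem C c (lift t 0) (B # \<Gamma>) = tm_sem C c t \<Gamma> \<cdot> Pr1 C (ctx_sem C c \<Gamma>) (ty_sem C c B)"
proof -
  define P where "P = (\<lambda>\<Gamma>' \<Gamma> m k. \<forall>i < length \<Gamma>. typing \<Gamma>' (lift (Var i) k) (\<Gamma> ! i) \<and>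
      tm_sem C c (lift (Var i) k) \<Gamma>' = var_sem C c \<Gamma> i \<cdot> m)"
  have up: "P (D # \<Gamma>') (D # \<Gamma>)
        (tuple C (m \<cdot> Pr1 C (ctx_sem C c \<Gamma>') (ty_sem C c D)) (Pr2 C (ctx_sem C c \<Gamma>') (ty_sem C c D)))
        (Suc k)" (is "P _ _ (tuple C (_ \<cdot> ?p) ?q) _")
    if *: "P \<Gamma>' \<Gamma> m k" and m: "m \<in> hom C (ctx_sem C c \<Gamma>') (ctx_sem C c \<Gamma>)" for \<Gamma>' \<Gamma> m k D
    unfolding P_def
  proof (intro allI impI)
    fix i assume i: "i < length (D # \<Gamma>)"
    have p: "?p \<in> hom C (ctx_sem C c (D # \<Gamma>')) (ctx_sem C c \<Gamma>')"
      and q: "?q \<in> hom C (ctx_sem C c (D # \<Gamma>')) (ty_sem C c D)"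
      by (simp_all add: Pr1_hom Pr2_hom)
    note tp = Pr1_tuple[OF Comp_hom[OF p m] q] Pr2_tuple[OF Comp_hom[OF p m] q]
      tuple_hom[OF Comp_hom[OF p m] q]
    show "typing (D # \<Gamma>') (lift (Var i) (Suc k)) ((D # \<Gamma>) ! i) \<and>
       tm_sem C c (lift (Var i) (Suc k)) (D # \<Gamma>') = var_sem C c (D # \<Gamma>) i \<cdot> tuple C (m \<cdot> ?p) ?q"
    proof (cases i)
      case 0
      then show ?thesis using tp typing.ty_Var[of 0 "D # \<Gamma>'"] by simp
    next
      case (Suc j)
      then have j: "j < length \<Gamma>" using i by simp
      obtain n where n: "lift (Var j) k = Var n" "lift (Var i) (Suc k) = Var (Suc n)"
        using Suc by (cases "j < k") auto
      have *: "typing \<Gamma>' (Var n) (\<Gamma> ! j)" "var_sem C c \<Gamma>' n = var_sem C c \<Gamma> j \<cdot> m"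
        using * j n unfolding P_def by (metis, metis tm_sem.simps(1))
      have "typing (D # \<Gamma>') (Var (Suc n)) (\<Gamma> ! j)"
        using *(1) typing.ty_Var[of "Suc n" "D # \<Gamma>'"] by (auto elim: typing.cases)
      moreover have "(var_sem C c \<Gamma> j \<cdot> m) \<cdot> ?p = var_sem C c \<Gamma> j \<cdot> m \<cdot> ?p"
        by (rule Comp_assoc[OF p m var_sem_hom[OF j]])
      moreover have "(var_sem C c \<Gamma> j \<cdot> Pr1 C (ctx_sem C c \<Gamma>) (ty_sem C c D)) \<cdot> tuple C (m \<cdot> ?p) ?q
          = var_sem C c \<Gamma> j \<cdot> m \<cdot> ?p"
        using Comp_assoc[OF tp(3) Pr1_hom var_sem_hom[OF j]] tp(1) by simp
      ultimately show ?thesis using Suc n(2) *(2) by simp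
    qed
  qed
  have "P (B # \<Gamma>) \<Gamma> (Pr1 C (ctx_sem C c \<Gamma>) (ty_sem C c B)) 0"
    unfolding P_def using typing.ty_Var[of "Suc _" "B # \<Gamma>"] by auto
  from tm_sem_transport[where P = P and act = lift and up = Suc, OF t _ this _ up] show ?thesis
    by (simp add: P_def Pr1_hom)
qed

lemma tm_sem_subst:
  assumes t: "typing (B # \<Gamma>) t A" and u: "typing \<Gamma> u B"
  shows "tm_sem C c (subst t u 0) \<Gamma>
       = tm_sem C c t (B # \<Gamma>) \<cdot> tuple C (Ide C (ctx_sem C c \<Gamma>)) (tm_sem C c u \<Gamma>)"
proof -
  define act where "act = (\<lambda>t (s, k). subst t s k)"
  define up where "up = (\<lambda>(s, k). (lift s 0, Suc k))"
  define P where "P = (\<lambda>\<Gamma>' \<Gamma> m \<theta>. \<forall>i < length \<Gamma>. typing \<Gamma>' (act (Var i) \<theta>) (\<Gamma> ! i) \<and>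
      tm_sem C c (act (Var i) \<theta>) \<Gamma>' = var_sem C c \<Gamma> i \<cdot> m)"
  have up: "P (D # \<Gamma>') (D # \<Gamma>)
        (tuple C (m \<cdot> Pr1 C (ctx_sem C c \<Gamma>') (ty_sem C c D)) (Pr2 C (ctx_sem C c \<Gamma>') (ty_sem C c D)))
        (up \<theta>)" (is "P _ _ (tuple C (_ \<cdot> ?p) ?q) _")
    if *: "P \<Gamma>' \<Gamma> m \<theta>" and m: "m \<in> hom C (ctx_sem C c \<Gamma>') (ctx_sem C c \<Gamma>)" for \<Gamma>' \<Gamma> m \<theta> D
    unfolding P_def
  proof (intro allI impI)
    fix i assume i: "i < length (D # \<Gamma>)"
    have p: "?p \<in> hom C (ctx_sem C c (D # \<Gamma>')) (ctx_sem C c \<Gamma>')"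
      and q: "?q \<in> hom C (ctx_sem C c (D # \<Gamma>')) (ty_sem C c D)"
      by (simp_all add: Pr1_hom Pr2_hom)
    note tp = Pr1_tuple[OF Comp_hom[OF p m] q] Pr2_tuple[OF Comp_hom[OF p m] q]
      tuple_hom[OF Comp_hom[OF p m] q]
    obtain s k where \<theta>: "\<theta> = (s, k)" by fastforce
    show "typing (D # \<Gamma>') (act (Var i) (up \<theta>)) ((D # \<Gamma>) ! i) \<and>
       tm_sem C c (act (Var i) (up \<theta>)) (D # \<Gamma>') = var_sem C c (D # \<Gamma>) i \<cdot> tuple C (m \<cdot> ?p) ?q"
    proof (cases i)
      case 0
      then show ?thesis using tp typing.ty_Var[of 0 "D # \<Gamma>'"] by (simp add: act_def up_def \<theta>)
    next
      case (Suc j)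
      then have j: "j < length \<Gamma>" using i by simp
      have eq: "act (Var i) (up \<theta>) = lift (act (Var j) \<theta>) 0"
        unfolding act_def up_def \<theta> Suc by (simp only: prod.case subst_Var_Suc)
      have *: "typing \<Gamma>' (act (Var j) \<theta>) (\<Gamma> ! j)"
        "tm_sem C c (act (Var j) \<theta>) \<Gamma>' = var_sem C c \<Gamma> j \<cdot> m"
        using * j unfolding P_def by blast+
      have "(var_sem C c \<Gamma> j \<cdot> m) \<cdot> ?p = var_sem C c \<Gamma> j \<cdot> m \<cdot> ?p"
        by (rule Comp_assoc[OF p m var_sem_hom[OF j]])
      moreover have "(var_sem C c \<Gamma> j \<cdot> Pr1 C (ctx_sem C c \<Gamma>) (ty_sem C c D)) \<cdot> tuple C (m \<cdot> ?p) ?q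
          = var_sem C c \<Gamma> j \<cdot> m \<cdot> ?p"
        using Comp_assoc[OF tp(3) Pr1_hom var_sem_hom[OF j]] tp(1) by simp
      ultimately show ?thesis unfolding eq
        using Suc * typing_lift[OF *(1)] tm_sem_lift[OF *(1)] by simp
    qed
  qed
  let ?m = "tuple C (Ide C (ctx_sem C c \<Gamma>)) (tm_sem C c u \<Gamma>)"
  note h = Ide_hom[OF ctx_sem_Obj[of \<Gamma>]] tm_sem_hom[OF u]
  have "P \<Gamma> (B # \<Gamma>) ?m (u, 0)"
    unfolding P_def
  proof (intro allI impI)
    fix i assume i: "i < length (B # \<Gamma>)"
    show "typing \<Gamma> (act (Var i) (u, 0)) ((B # \<Gamma>) ! i) \<and>
         tm_sem C c (act (Var i) (u, 0)) \<Gamma> = var_sem C c (B # \<Gamma>) i \<cdot> ?m"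
      using typing_subst_Var[OF u i] i Pr2_tuple[OF h] Pr1_tuple[OF h]
        Comp_assoc[OF tuple_hom[OF h] Pr1_hom var_sem_hom] Comp_Ide[OF var_sem_hom]
      by (cases i) (auto simp: act_def)
  qed
  from tm_sem_transport[where P = P and act = act and up = up, OF t _ this _ up] tuple_hom[OF h]
  show ?thesis by (simp add: P_def act_def up_def split_beta)
qed

lemma tm_sem_sound: "beta_eta \<Gamma> t u A \<Longrightarrow> tm_sem C c t \<Gamma> = tm_sem C c u \<Gamma>"
proof (induction rule: beta_eta.induct)
  case (be_App \<Gamma> t t' A B u u')
  then have "ty_of t \<Gamma> = Fun A B" "ty_of t' \<Gamma> = Fun A B"
    using beta_eta_typing ty_of_eq by blast+
  then show ?case using be_App.IH by simp
next
  case (be_Fst \<Gamma> t u A B)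
  then have "ty_of t \<Gamma> = Prod A B" "ty_of u \<Gamma> = Prod A B"
    using beta_eta_typing ty_of_eq by blast+
  then show ?case using be_Fst.IH by simp
next
  case (be_Snd \<Gamma> t u A B)
  then have "ty_of t \<Gamma> = Prod A B" "ty_of u \<Gamma> = Prod A B"
    using beta_eta_typing ty_of_eq by blast+
  then show ?case using be_Snd.IH by simp
next
  case (beta_Fun A \<Gamma> t B u)
  let ?G = "ctx_sem C c \<Gamma>" and ?A = "ty_sem C c A" and ?B = "ty_sem C c B"
  let ?t = "tm_sem C c t (A # \<Gamma>)" and ?u = "tm_sem C c u \<Gamma>"
  note t = tm_sem_hom[OF beta_Fun.hyps(1), unfolded ctx_sem.simps]
  note u = tm_sem_hom[OF beta_Fun.hyps(2)]
  note k = curry_hom[OF ctx_sem_Obj ty_sem_Obj t]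
  have "ccc_uncurry C ?G ?A ?B (ccc_curry C ?G ?A ?t) \<cdot> tuple C (Ide C ?G) ?u
      = Eval C ?A ?B \<cdot> tuple C (ccc_curry C ?G ?A ?t \<cdot> Ide C ?G) ?u"
    by (rule uncurry_comp_tuple[OF _ _ _ k Ide_hom u]) simp_all
  then show ?case
    using tm_sem_subst[OF beta_Fun.hyps] uncurry_curry[OF ctx_sem_Obj ty_sem_Obj t] Comp_Ide[OF k]
      ty_of_eq[OF beta_Fun.hyps(1)] by simp
next
  case (beta_Fst \<Gamma> t A u B)
  then show ?case using Pr1_tuple[OF tm_sem_hom tm_sem_hom] by (simp add: ty_of_eq)
next
  case (beta_Snd \<Gamma> t A u B)
  then show ?case using Pr2_tuple[OF tm_sem_hom tm_sem_hom] by (simp add: ty_of_eq)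
next
  case (eta_Fun \<Gamma> t A B)
  let ?G = "ctx_sem C c \<Gamma>" and ?A = "ty_sem C c A" and ?B = "ty_sem C c B"
  have "tm_sem C c t \<Gamma> = ccc_curry C ?G ?A (ccc_uncurry C ?G ?A ?B (tm_sem C c t \<Gamma>))"
    using tm_sem_hom[OF eta_Fun.hyps] by (intro curry_unique[where c = ?B]) simp_all
  from this[symmetric] show ?case
    using ty_of_eq[OF typing_lift[OF eta_Fun.hyps]] tm_sem_lift[OF eta_Fun.hyps]
    by (simp add: ccc_uncurry_def)
next
  case (eta_Prod \<Gamma> t A B)
  have "tm_sem C c t \<Gamma> = tuple C (Pr1 C (ty_sem C c A) (ty_sem C c B) \<cdot> tm_sem C c t \<Gamma>)
      (Pr2 C (ty_sem C c A) (ty_sem C c B) \<cdot> tm_sem C c t \<Gamma>)"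
    using tm_sem_hom[OF eta_Prod.hyps] by (intro tuple_unique) simp_all
  from this[symmetric] show ?case using ty_of_eq[OF eta_Prod.hyps] by simp
next
  case (eta_Unit \<Gamma> t)
  then show ?case using bang_unique[OF tm_sem_hom[OF eta_Unit.hyps, unfolded ty_sem.simps]] by simp
qed simp_all

lemma Tm_sem_eq:
  assumes "typing [] t A"
  shows "Tm_sem C c (conv A `` {t}) = tm_sem C c t []"
proof -
  have "(\<lambda>t. tm_sem C c t []) ` (conv A `` {t}) = {tm_sem C c t []}"
  proof
    show "(\<lambda>t. tm_sem C c t []) ` (conv A `` {t}) \<subseteq> {tm_sem C c t []}"
      by (auto simp: conv_def dest: tm_sem_sound)
    have "t \<in> conv A `` {t}" using beta_eta.be_refl[OF assms] by (simp add: conv_def)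
    then show "{tm_sem C c t []} \<subseteq> (\<lambda>t. tm_sem C c t []) ` (conv A `` {t})" by blast
  qed
  then show ?thesis by (simp add: Tm_sem_def)
qed

lemma Tm_sem_hom: "T \<in> Tm A \<Longrightarrow> Tm_sem C c T \<in> hom C (One C) (ty_sem C c A)"
  using tm_sem_hom[of "[]"] by (auto elim!: TmE simp: Tm_sem_eq)

end

end

end

theory Submission
  imports Defs
begin

text \<open>Interpreting \<open>t[B]\<close> at \<open>c\<close> is the same as interpreting \<open>t\<close> at \<open>e = [[B]]\<^sub>c\<close>, so take for \<open>F\<close>
  the points of \<open>[[A]]\<^sub>e\<close> that \<open>[[r]]\<^sub>c\<close> sends to \<open>[[true]]\<^sub>c\<close>. This works as soon as the interpretation
  at \<open>c\<close> reflects equality with \<open>true\<close>. By a logical predicate over terms in the single context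
  \<open>x : o \<times> o\<close>, every closed term of type \<open>Bool\<close> is convertible to \<open>true\<close> or \<open>false\<close>; and if \<open>c\<close> is
  the target of two distinct arrows \<open>f, g\<close>, the two projections of \<open>c \<times> c\<close> are separated by
  \<open>\<langle>f, g\<rangle>\<close>, so \<open>true\<close> and \<open>false\<close> have distinct interpretations.\<close>

section \<open>Parallel substitution\<close>

lemma lift_lift: "i \<le> k \<Longrightarrow> lift (lift t i) (Suc k) = lift (lift t k) i"
  by (induction t arbitrary: i k) auto

lemma subst_lift_cancel: "subst (lift t k) u k = t"
  by (induction t arbitrary: k u) auto

lemma subst_lift_lift: "j \<le> k \<Longrightarrow> subst (lift t j) (lift u j) (Suc k) = lift (subst t u k) j"
proof (induction t arbitrary: j k u)
  case (Lam A t)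
  then show ?case using lift_lift[of 0 j u] Lam.IH[of "Suc j" "Suc k" "lift u 0"] by simp
qed auto

definition up :: "(nat \<Rightarrow> tm) \<Rightarrow> nat \<Rightarrow> tm" where
  "up \<sigma> = case_nat (Var 0) (\<lambda>i. lift (\<sigma> i) 0)"

text \<open>All variables are replaced at once because the fundamental lemma
  \<open>bool_pred_psubst\<close> instantiates an entire context.\<close>

primrec psubst :: "tm \<Rightarrow> (nat \<Rightarrow> tm) \<Rightarrow> tm" where
  "psubst (Var i) \<sigma> = \<sigma> i"
| "psubst (Lam A t) \<sigma> = Lam A (psubst t (up \<sigma>))"
| "psubst (App t u) \<sigma> = App (psubst t \<sigma>) (psubst u \<sigma>)"
| "psubst (MkPair t u) \<sigma> = MkPair (psubst t \<sigma>) (psubst u \<sigma>)"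
| "psubst (Fst t) \<sigma> = Fst (psubst t \<sigma>)"
| "psubst (Snd t) \<sigma> = Snd (psubst t \<sigma>)"
| "psubst Star \<sigma> = Star"

lemma psubst_Var: "psubst t Var = t"
proof -
  have "up Var = Var" by (rule ext) (simp add: up_def split: nat.split)
  then show ?thesis by (induction t) auto
qed

lemma subst_psubst: "subst (psubst t \<sigma>) u k = psubst t (\<lambda>i. subst (\<sigma> i) u k)"
proof (induction t arbitrary: \<sigma> u k)
  case (Lam A t)
  have "(\<lambda>i. subst (up \<sigma> i) (lift u 0) (Suc k)) = up (\<lambda>i. subst (\<sigma> i) u k)"
    by (rule ext) (simp add: up_def subst_lift_lift split: nat.split)
  then show ?case using Lam by simp
qed auto

text \<open>The contractum of \<open>App (psubst (Lam A t) \<sigma>) u\<close> is again a parallel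
  substitution instance of \<open>t\<close>, so an induction hypothesis on \<open>t\<close> applies
  to it.\<close>

lemma subst_psubst_up: "subst (psubst t (up \<sigma>)) u 0 = psubst t (case_nat u \<sigma>)"
proof -
  have "(\<lambda>i. subst (up \<sigma> i) u 0) = case_nat u \<sigma>"
    by (rule ext) (simp add: up_def subst_lift_cancel split: nat.split)
  then show ?thesis by (simp add: subst_psubst)
qed

lemma typing_psubst:
  "typing \<Gamma> t A \<Longrightarrow> (\<And>i. i < length \<Gamma> \<Longrightarrow> typing \<Delta> (\<sigma> i) (\<Gamma> ! i)) \<Longrightarrow> typing \<Delta> (psubst t \<sigma>) A"
proof (induction arbitrary: \<Delta> \<sigma> rule: typing.induct)
  case (ty_Lam A \<Gamma> t B)
  have "typing (A # \<Delta>) (up \<sigma> i) ((A # \<Gamma>) ! i)" if "i < length (A # \<Gamma>)" for i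
    using that ty_Lam.prems typing.ty_Var[of 0 "A # \<Delta>"]
    by (cases i) (auto simp: up_def intro: typing_lift)
  then show ?case using ty_Lam.IH by (auto intro: typing.ty_Lam)
next
  case (ty_App \<Gamma> t A B u)
  then show ?case by (metis psubst.simps(3) typing.ty_App)
qed (auto intro: typing.intros)

section \<open>Closed Booleans\<close>

definition false_tm :: tm where
  "false_tm = Lam (Prod Base Base) (Snd (Var 0))"

lemma typing_true_tm: "typing [] true_tm Bool"
  unfolding true_tm_def Bool_def
  using typing.ty_Var[of 0 "[Prod Base Base]"] by (auto intro!: typing.intros)

text \<open>Terms live in the fixed context \<open>[o \<times> o]\<close>: no Kripke-style quantification over context
  extensions is needed, as the predicate is only used to compute values at type \<open>o\<close>.\<close>

primrec bool_pred :: "ty \<Rightarrow> tm \<Rightarrow> bool" where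
  "bool_pred Base t \<longleftrightarrow> beta_eta [Prod Base Base] t (Fst (Var 0)) Base \<or>
     beta_eta [Prod Base Base] t (Snd (Var 0)) Base"
| "bool_pred (Fun A B) t \<longleftrightarrow> typing [Prod Base Base] t (Fun A B) \<and>
     (\<forall>u. bool_pred A u \<longrightarrow> bool_pred B (App t u))"
| "bool_pred (Prod A B) t \<longleftrightarrow> typing [Prod Base Base] t (Prod A B) \<and>
     bool_pred A (Fst t) \<and> bool_pred B (Snd t)"
| "bool_pred Unit t \<longleftrightarrow> typing [Prod Base Base] t Unit"

lemma bool_pred_typing: "bool_pred A t \<Longrightarrow> typing [Prod Base Base] t A"
  by (cases A) (auto dest: beta_eta_typing)

text \<open>Transitivity settles \<open>Base\<close>; compound types reduce to their components
  since conversion is a congruence. Used to pass from a contractum back to its redex.\<close>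

lemma bool_pred_conv:
  "bool_pred A t \<Longrightarrow> beta_eta [Prod Base Base] u t A \<Longrightarrow> bool_pred A u"
proof (induction A arbitrary: t u)
  case Base
  then show ?case by (auto intro: beta_eta.be_trans)
next
  case (Fun A B)
  have "bool_pred B (App u v)" if "bool_pred A v" for v
    using Fun.IH(2)[of "App t v"] Fun.prems that
      beta_eta.be_App[OF Fun.prems(2) beta_eta.be_refl[OF bool_pred_typing[OF that]]] by simp
  then show ?case using Fun.prems(2) by (auto dest: beta_eta_typing)
next
  case (Prod A B)
  have "bool_pred A (Fst u)"
    using Prod.IH(1)[OF _ beta_eta.be_Fst[OF Prod.prems(2)]] Prod.prems(1) by simp
  moreover have "bool_pred B (Snd u)"
    using Prod.IH(2)[OF _ beta_eta.be_Snd[OF Prod.prems(2)]] Prod.prems(1) by simp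
  ultimately show ?case using Prod.prems(2) by (auto dest: beta_eta_typing)
next
  case Unit
  then show ?case by (auto dest: beta_eta_typing)
qed

text \<open>Fundamental lemma of the logical predicate. Eliminations follow from its definition;
  abstractions and pairs use that a beta-redex inherits it from its contractum.\<close>

lemma bool_pred_psubst:
  "typing \<Gamma> t A \<Longrightarrow> (\<And>i. i < length \<Gamma> \<Longrightarrow> bool_pred (\<Gamma> ! i) (\<sigma> i)) \<Longrightarrow> bool_pred A (psubst t \<sigma>)"
proof (induction arbitrary: \<sigma> rule: typing.induct)
  case (ty_Lam A \<Gamma> t B)
  have lam: "typing [Prod Base Base] (psubst (Lam A t) \<sigma>) (Fun A B)"
    using typing_psubst[OF typing.ty_Lam[OF ty_Lam.hyps]] ty_Lam.prems bool_pred_typing by blast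
  then have body: "typing [A, Prod Base Base] (psubst t (up \<sigma>)) B"
    by (auto elim: typing.cases)
  have "bool_pred B (App (psubst (Lam A t) \<sigma>) u)" if u: "bool_pred A u" for u
  proof (rule bool_pred_conv)
    show "bool_pred B (psubst t (case_nat u \<sigma>))"
      using ty_Lam.prems u by (intro ty_Lam.IH) (auto simp: less_Suc_eq_0_disj)
    show "beta_eta [Prod Base Base] (App (psubst (Lam A t) \<sigma>) u) (psubst t (case_nat u \<sigma>)) B"
      using beta_eta.beta_Fun[OF body bool_pred_typing[OF u]] by (simp add: subst_psubst_up)
  qed
  then show ?case using lam by simp
next
  case (ty_Pair \<Gamma> t A u B)
  then have t: "bool_pred A (psubst t \<sigma>)" and u: "bool_pred B (psubst u \<sigma>)" by blast+
  note typings = t[THEN bool_pred_typing] u[THEN bool_pred_typing]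
  show ?case
    using bool_pred_conv[OF t beta_eta.beta_Fst[OF typings]]
      bool_pred_conv[OF u beta_eta.beta_Snd[OF typings]] typings
    by (auto intro: typing.ty_Pair)
qed (auto intro: typing.intros)

lemma closed_Bool_cases:
  assumes t: "typing [] t Bool"
  shows "beta_eta [] t true_tm Bool \<or> beta_eta [] t false_tm Bool"
proof -
  let ?P = "Prod Base Base"
  let ?u = "App (lift t 0) (Var 0)"
  have x: "typing [?P] (Var 0) ?P" using typing.ty_Var[of 0 "[?P]"] by simp
  \<comment> \<open>Besides typing, this asks for the two projections of the variable, which are
    exactly the values allowed at \<open>Base\<close>.\<close>
  have "bool_pred ?P (Var 0)"
    using x by (auto intro: beta_eta.be_refl typing.intros)
  moreover have "typing [?P] ?u Base"
    using typing_lift[OF t, of ?P] x by (auto simp: Bool_def intro: typing.ty_App)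
  ultimately have "bool_pred Base ?u"
    using bool_pred_psubst[of "[?P]" ?u Base Var] by (simp add: psubst_Var)
  \<comment> \<open>The body is convertible to a projection of the variable; abstracting again and
    undoing the eta-expansion gives the claim for \<open>t\<close>.\<close>
  then have "beta_eta [] (Lam ?P ?u) true_tm Bool \<or> beta_eta [] (Lam ?P ?u) false_tm Bool"
    unfolding true_tm_def false_tm_def Bool_def by (auto intro: beta_eta.be_Lam)
  moreover have "beta_eta [] t (Lam ?P ?u) Bool"
    using beta_eta.be_sym[OF beta_eta.eta_Fun] t unfolding Bool_def by blast
  ultimately show ?thesis by (blast intro: beta_eta.be_trans)
qed

section \<open>Type instantiation and the interpretation\<close>

lemma ty_sem_inst: "ty_sem C c (ty_inst A B) = ty_sem C (ty_sem C c B) A"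
  by (induction A) auto

lemma ctx_sem_inst: "ctx_sem C c (map (\<lambda>A. ty_inst A B) \<Gamma>) = ctx_sem C (ty_sem C c B) \<Gamma>"
  by (induction \<Gamma>) (auto simp: ty_sem_inst)

lemma var_sem_inst:
  "var_sem C c (map (\<lambda>A. ty_inst A B) \<Gamma>) i = var_sem C (ty_sem C c B) \<Gamma> i"
  by (induction \<Gamma> arbitrary: i) (auto simp: ty_sem_inst ctx_sem_inst split: nat.split)

text \<open>Typability matters because \<open>tm_sem\<close> branches on \<open>ty_of\<close>, and
  instantiation could turn a \<open>Base\<close> found there into a function or product
  type.\<close>

lemma tm_sem_inst:
  "typing \<Gamma> t A \<Longrightarrow>
   tm_sem C c (tm_inst t B) (map (\<lambda>A. ty_inst A B) \<Gamma>) = tm_sem C (ty_sem C c B) t \<Gamma>"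
proof (induction rule: typing.induct)
  case (ty_App \<Gamma> t A1 A2 u)
  then show ?case
    using ty_of_eq[OF typing_inst[OF ty_App.hyps(1), of B]] by (simp add: ty_of_eq ty_sem_inst)
next
  case (ty_Fst \<Gamma> t A1 A2)
  then show ?case
    using ty_of_eq[OF typing_inst[OF ty_Fst.hyps, of B]] by (simp add: ty_of_eq ty_sem_inst)
next
  case (ty_Snd \<Gamma> t A1 A2)
  then show ?case
    using ty_of_eq[OF typing_inst[OF ty_Snd.hyps, of B]] by (simp add: ty_of_eq ty_sem_inst)
qed (auto simp: var_sem_inst ty_sem_inst ctx_sem_inst)

section \<open>Separating the Booleans\<close>

context cartesian_closed_category
begin

lemma true_false_sem_distinct:
  assumes f: "f \<in> hom C c' c" and g: "g \<in> hom C c' c" and "f \<noteq> g"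
  shows "tm_sem C c true_tm [] \<noteq> tm_sem C c false_tm []"
proof
  assume eq: "tm_sem C c true_tm [] = tm_sem C c false_tm []"
  have c': "c' \<in> Obj C" and c: "c \<in> Obj C" using hom_ObjD[OF f] by auto
  let ?P = "Times C c c"
  have P: "?P \<in> Obj C" using c Times_Obj by blast
  note q = Pr2_hom[OF One_Obj P]
  note p1 = Pr1_hom[OF c c] and p2 = Pr2_hom[OF c c]
  have "ccc_curry C (One C) ?P (Pr1 C c c \<cdot> Pr2 C (One C) ?P)
      = ccc_curry C (One C) ?P (Pr2 C c c \<cdot> Pr2 C (One C) ?P)"
    using eq by (simp add: true_tm_def false_tm_def)
  \<comment> \<open>Uncurrying is a left inverse of currying, so the bodies agree.\<close>
  then have *: "Pr1 C c c \<cdot> Pr2 C (One C) ?P = Pr2 C c c \<cdot> Pr2 C (One C) ?P"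
    using uncurry_curry[OF One_Obj P Comp_hom[OF q p1]] uncurry_curry[OF One_Obj P Comp_hom[OF q p2]]
    by metis
  note fg = tuple_hom[OF f g]
  \<comment> \<open>The bodies start at the context object \<open>1 \<times> (c \<times> c)\<close>,
    so the separating pair is padded with the arrow to the terminal object.\<close>
  let ?m = "tuple C (bang C c') (tuple C f g)"
  note m = tuple_hom[OF bang_hom[OF c'] fg]
  have "f = (Pr1 C c c \<cdot> Pr2 C (One C) ?P) \<cdot> ?m"
    using Comp_assoc[OF m q p1] Pr2_tuple[OF bang_hom[OF c'] fg] Pr1_tuple[OF f g] by simp
  also have "\<dots> = g"
    unfolding *
    using Comp_assoc[OF m q p2] Pr2_tuple[OF bang_hom[OF c'] fg] Pr2_tuple[OF f g] by simp
  finally show False using \<open>f \<noteq> g\<close> by contradiction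
qed

text \<open>A Boolean not convertible to true is convertible to false, so by soundness its
  interpretation is that of false, which differs from that of true.\<close>

lemma tm_sem_true_iff:
  assumes f: "f \<in> hom C c' c" and g: "g \<in> hom C c' c" and "f \<noteq> g" and t: "typing [] t Bool"
  shows "tm_sem C c t [] = tm_sem C c true_tm [] \<longleftrightarrow> conv Bool `` {t} = true_class"
proof
  have c: "c \<in> Obj C" using hom_ObjD[OF f] by auto
  assume "tm_sem C c t [] = tm_sem C c true_tm []"
  then have "\<not> beta_eta [] t false_tm Bool"
    using tm_sem_sound[OF c] true_false_sem_distinct[OF assms(1-3)] by metis
  then have "(t, true_tm) \<in> conv Bool"
    using closed_Bool_cases[OF t] by (auto simp: conv_def)
  then show "conv Bool `` {t} = true_class"
    unfolding true_class_def by (rule equiv_class_eq[OF equiv_conv])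
next
  have c: "c \<in> Obj C" using hom_ObjD[OF f] by auto
  assume "conv Bool `` {t} = true_class"
  then show "tm_sem C c t [] = tm_sem C c true_tm []"
    unfolding true_class_def using Tm_sem_eq[OF c] t typing_true_tm by metis
qed

lemma syntactically_recognizable_imp_recognizable:
  assumes f: "f \<in> hom C c' c" and g: "g \<in> hom C c' c" and "f \<noteq> g"
    and "syntactically_recognizable A L"
  shows "recognizable C A L"
proof -
  have c: "c \<in> Obj C" using hom_ObjD[OF f] by auto
  obtain B R where R: "R \<in> Tm (Fun (ty_inst A B) Bool)"
    and L: "L = {T \<in> Tm A. Tm_app Bool R (Tm_inst (ty_inst A B) T B) = true_class}"
    using assms(4) unfolding syntactically_recognizable_def by blast
  obtain r where r: "typing [] r (Fun (ty_inst A B) Bool)"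
    and R_eq: "R = conv (Fun (ty_inst A B) Bool) `` {r}"
    using TmE[OF R] by blast
  define e where "e = ty_sem C c B"
  have e: "e \<in> Obj C" unfolding e_def using c by simp
  \<comment> \<open>The composite is the interpretation of an application of \<open>r\<close>, with
    \<open>h\<close> in place of the argument.\<close>
  define F where "F = {h \<in> hom C (One C) (ty_sem C e A).
    Eval C (ty_sem C e A) (ty_sem C c Bool) \<cdot> tuple C (tm_sem C c r []) h = tm_sem C c true_tm []}"
  have "Tm_app Bool R (Tm_inst (ty_inst A B) T B) = true_class \<longleftrightarrow> Tm_sem C e T \<in> F"
    if T: "T \<in> Tm A" for T
  proof -
    obtain t where t: "typing [] t A" and T_eq: "T = conv A `` {t}" using TmE[OF T] by blast
    have tB: "typing [] (tm_inst t B) (ty_inst A B)" using typing_inst[OF t, of B] by simp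
    have "Tm_app Bool R (Tm_inst (ty_inst A B) T B) = conv Bool `` {App r (tm_inst t B)}"
      by (simp add: R_eq T_eq Tm_inst_eq[OF t] Tm_app_eq[OF r tB])
    moreover have "tm_sem C c (App r (tm_inst t B)) []
        = Eval C (ty_sem C e A) (ty_sem C c Bool) \<cdot> tuple C (tm_sem C c r []) (Tm_sem C e T)"
      using tm_sem_inst[OF t, of C c B]
      by (simp add: ty_of_eq[OF r] ty_sem_inst T_eq Tm_sem_eq[OF e t] flip: e_def)
    ultimately show ?thesis
      using tm_sem_true_iff[OF assms(1-3) typing.ty_App[OF r tB]] Tm_sem_hom[OF e T]
      by (simp add: F_def)
  qed
  then have "L = {T \<in> Tm A. Tm_sem C e T \<in> F}" using L by blast
  moreover have "F \<subseteq> hom C (One C) (ty_sem C e A)" unfolding F_def by blast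
  ultimately show ?thesis unfolding recognizable_def using e by blast
qed

end

theorem theorem3p2:
  fixes C :: "('o, 'm) ccc"
  assumes "cartesian_closed_category C"
    and "nondegenerate C"
  shows "\<forall>A. \<forall>L \<subseteq> Tm A. syntactically_recognizable A L \<longrightarrow> recognizable C A L"
  using assms(2) cartesian_closed_category.syntactically_recognizable_imp_recognizable[OF assms(1)]
  unfolding nondegenerate_def by blast

end
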